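(* Let $k$ be a field of characteristic zero and $V=\{v_i\}_{i\in\mathbb N^\ast}$. The $k_V$-linear map $\gamma:\mathbf{QSh}^g_d(V)\to\mathbf{QSym}_V$ defined by $\gamma(\emptyset)=\emptyset$ and, for pairwise distinct indices $i_1,\dots,i_r$, $$\gamma([v_{i_1}\dots v_{i_r}])=\sum_{n_1,\dots,n_r\ge1}v_{i_1}^{n_1-1}\cdots v_{i_r}^{n_r-1}\,[n_1\dots n_r]$$ is a regularizing bialgebra map from $\mathbf{QSh}^g_d(V)$ to $\mathbf{QSym}_V$.
   Context: $k_V=k((V))$ is the field of fractions of the ring $k[[V]]$ of formal power series in the variables $v_i$, $i\in\mathbb N^\ast$ (positive integers). The same symbols $v_i$ are used as letters of the alphabet $V$ (inside brackets) and as scalars of $k_V$. A word over $V$ is generic if no letter appears twice; two generic words are in generic position if they have no letter in common; linear combinations of generic words are in generic position if every pair of words occurring in them is. The generic divided quasi-shuffle bialgebra $\mathbf{QSh}^g_d(V)$ is the $k_V$-span $T^g(V)$ of generic words $[v_{i_1}\dots v_{i_r}]$, with deconcatenation coproduct $\Delta([v_{i_1}\dots v_{i_r}])=\sum_{j=0}^r[v_{i_1}\dots v_{i_j}]\otimes[v_{i_{j+1}}\dots v_{i_r}]$ and the partially defined product $\overline\star$ with unit the empty word $\emptyset$, given recursively for words in generic position by $$[v_{i_1}\dots v_{i_r}]\,\overline\star\,[v_{i_{r+1}}\dots v_{i_{r+s}}]=[v_{i_1}(v_{i_2}\dots v_{i_r}\,\overline\star\,v_{i_{r+1}}\dots v_{i_{r+s}})]+[v_{i_{r+1}}(v_{i_1}\dots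 v_{i_r}\,\overline\star\,v_{i_{r+2}}\dots v_{i_{r+s}})]$$ $$+\frac1{v_{i_1}-v_{i_{r+1}}}\big\{[v_{i_1}(v_{i_2}\dots v_{i_r}\,\overline\star\,v_{i_{r+2}}\dots v_{i_{r+s}})]-[v_{i_{r+1}}(v_{i_2}\dots v_{i_r}\,\overline\star\,v_{i_{r+2}}\dots v_{i_{r+s}})]\big\},$$ where $[v(w)]$ is concatenation of the letter $v$ in front of $w$. $\mathbf{QSym}_V$ is the completion of the bialgebra $\mathbf{QSym}$ over the base field $k_V$ with respect to the grading in which the word $[n_1\dots n_r]$ has degree $n_1+\dots+n_r$ (i.e. possibly infinite $k_V$-linear combinations of words; the coproduct takes values in the completed tensor product). Here $\mathbf{QSym}$ is the span of words $[n_1\dots n_r]$, $n_i\in\mathbb N^\ast$, $r\ge 0$, with deconcatenation coproduct and quasi-shuffle product $\star$ (unit $\emptyset$) $$[n_1\dots n_r]\star[m_1\dots m_s]=[n_1(n_2\dots n_r\star m_1\dots m_s)]+[m_1(n_1\dots n_r\star m_2\dots m_s)]+[(n_1+m_1)(n_2\dots n_r\star m_2\dots m_s)].$$ A regularizing bialgebra map $f$ from a generic bialgebra $H$ (product $\mu$ defined on elements in generic position, coproduct $\Delta$) to a bialgebra $H'$ (product $\mu'$, coproduct $\Delta'$) is a linear map, respecting word length, which sends the unit to the unit and satisfies $f(\mu(h\otimes h'))=\mu'(f(h)\otimes f(h'))$ for all $h,h'$ in generic position and $(f\otimes f)\circ\Delta=\Delta'\circ f$. *)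

theory Defs
  imports Complex_Main "HOL-Library.Poly_Mapping" "HOL-Computational_Algebra.Fraction_Field"
begin

abbreviation lookup :: "('a \<Rightarrow>\<^sub>0 'b::zero) \<Rightarrow> 'a \<Rightarrow> 'b" where
  "lookup \<equiv> Poly_Mapping.lookup"

abbreviation keys :: "('a \<Rightarrow>\<^sub>0 'b::zero) \<Rightarrow> 'a set" where
  "keys \<equiv> Poly_Mapping.keys"


section \<open>Positive integers\<close>

typedef posnat = "{n::nat. n > 0}" morphisms nat_of Abs_posnat
  by auto

setup_lifting type_definition_posnat

instantiation posnat :: linorder
begin
lift_definition less_eq_posnat :: "posnat \<Rightarrow> posnat \<Rightarrow> bool" is "(\<le>)" .
lift_definition less_posnat :: "posnat \<Rightarrow> posnat \<Rightarrow> bool" is "(<)" .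
instance by standard (transfer; auto)+
end

instantiation posnat :: ab_semigroup_add
begin
lift_definition plus_posnat :: "posnat \<Rightarrow> posnat \<Rightarrow> posnat" is "(+)" by simp
instance by standard (transfer; simp)+
end


section \<open>Formal power series in arbitrarily many variables\<close>

text \<open>
  A monomial in variables indexed by \<open>'i\<close> is a finitely supported exponent function, and a power
  series is an arbitrary family of coefficients. For infinite \<open>'i\<close> this is the full power series
  ring: a series may involve infinitely many variables.
\<close>

typedef ('i, 'a) mfps = "UNIV :: (('i \<Rightarrow>\<^sub>0 nat) \<Rightarrow> 'a) set"
  morphisms mfps_nth Abs_mfps ..

setup_lifting type_definition_mfps

lemma mfps_eqI: "(\<And>m. mfps_nth f m = mfps_nth g m) \<Longrightarrow> f = g"
  by (simp add: mfps_nth_inject[symmetric] fun_eq_iff)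

lemma finite_exponent_le: "finite {a :: 'i \<Rightarrow>\<^sub>0 nat. \<forall>i. lookup a i \<le> lookup m i}" (is "finite ?A")
proof -
  let ?M = "Max (insert 0 (lookup m ` keys m))"
  let ?B = "{f. \<forall>i. (i \<in> keys m \<longrightarrow> f i \<in> {..?M}) \<and> (i \<notin> keys m \<longrightarrow> f i = (0::nat))}"
  have "finite ?B" by (rule finite_set_of_finite_funs) auto
  moreover have "lookup ` ?A \<subseteq> ?B"
  proof clarsimp
    fix a :: "'i \<Rightarrow>\<^sub>0 nat" and i
    assume a: "\<forall>i. lookup a i \<le> lookup m i"
    have "lookup a i \<le> ?M" if "i \<in> keys m"
      using a that by (intro order_trans[OF a[rule_format, of i]] Max_ge) auto
    moreover have "lookup a i = 0" if "i \<notin> keys m"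
      using a[rule_format, of i] that by (simp add: in_keys_iff)
    ultimately show "(i \<in> keys m \<longrightarrow> lookup a i \<le> ?M) \<and> (i \<notin> keys m \<longrightarrow> lookup a i = 0)"
      by blast
  qed
  ultimately have "finite (lookup ` ?A)" by (rule rev_finite_subset)
  then show ?thesis by (rule finite_imageD) (simp add: inj_on_def lookup_inject)
qed

lemma finite_exponent_pairs: "finite {(a :: 'i \<Rightarrow>\<^sub>0 nat, b). a + b = m}"
  by (rule finite_subset[OF _ finite_cartesian_product[OF finite_exponent_le finite_exponent_le], of _ m m])
     (auto simp: lookup_add)

instantiation mfps :: (type, comm_ring_1) comm_ring_1
begin

lift_definition zero_mfps :: "('a, 'b) mfps" is "\<lambda>_. 0" .
lift_definition one_mfps :: "('a, 'b) mfps" is "\<lambda>m. if m = 0 then 1 else 0" .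
lift_definition plus_mfps :: "('a, 'b) mfps \<Rightarrow> ('a, 'b) mfps \<Rightarrow> ('a, 'b) mfps"
  is "\<lambda>f g m. f m + g m" .
lift_definition minus_mfps :: "('a, 'b) mfps \<Rightarrow> ('a, 'b) mfps \<Rightarrow> ('a, 'b) mfps"
  is "\<lambda>f g m. f m - g m" .
lift_definition uminus_mfps :: "('a, 'b) mfps \<Rightarrow> ('a, 'b) mfps" is "\<lambda>f m. - f m" .
lift_definition times_mfps :: "('a, 'b) mfps \<Rightarrow> ('a, 'b) mfps \<Rightarrow> ('a, 'b) mfps"
  is "\<lambda>f g m. \<Sum>(a, b) | a + b = m. f a * g b" .

instance
proof
  fix f g h :: "('a, 'b) mfps"
  show "f * g * h = f * (g * h)"
  proof (rule mfps_eqI)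
    fix m :: "'a \<Rightarrow>\<^sub>0 nat"
    let ?P = "\<lambda>m. {(a :: 'a \<Rightarrow>\<^sub>0 nat, b). a + b = m}"
    note fin = finite_exponent_pairs
    have "mfps_nth (f * g * h) m = (\<Sum>p\<in>?P m. \<Sum>q\<in>?P (fst p).
        mfps_nth f (fst q) * mfps_nth g (snd q) * mfps_nth h (snd p))"
      by (simp add: times_mfps.rep_eq sum_distrib_right split_def)
    also have "\<dots> = (\<Sum>(p, q)\<in>Sigma (?P m) (\<lambda>p. ?P (fst p)).
        mfps_nth f (fst q) * mfps_nth g (snd q) * mfps_nth h (snd p))"
      by (rule sum.Sigma) (use fin in auto)
    also have "\<dots> = (\<Sum>(p, q)\<in>Sigma (?P m) (\<lambda>p. ?P (snd p)).
        mfps_nth f (fst p) * (mfps_nth g (fst q) * mfps_nth h (snd q)))"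
      by (rule sum.reindex_bij_witness[of _
            "\<lambda>(p, q). ((fst p + fst q, snd q), (fst p, fst q))"
            "\<lambda>(p, q). ((fst q, snd q + snd p), (snd q, snd p))"])
         (auto simp: ac_simps)
    also have "\<dots> = (\<Sum>p\<in>?P m. \<Sum>q\<in>?P (snd p).
        mfps_nth f (fst p) * (mfps_nth g (fst q) * mfps_nth h (snd q)))"
      by (rule sum.Sigma[symmetric]) (use fin in auto)
    also have "\<dots> = mfps_nth (f * (g * h)) m"
      by (simp add: times_mfps.rep_eq sum_distrib_left split_def)
    finally show "mfps_nth (f * g * h) m = mfps_nth (f * (g * h)) m" .
  qed
  show "f * g = g * f"
  proof (rule mfps_eqI)
    fix m
    show "mfps_nth (f * g) m = mfps_nth (g * f) m"
      unfolding times_mfps.rep_eq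
      by (rule sum.reindex_bij_witness[of _ prod.swap prod.swap]) (auto simp: ac_simps)
  qed
  show "1 * f = f"
  proof (rule mfps_eqI)
    fix m :: "'a \<Rightarrow>\<^sub>0 nat"
    have "mfps_nth (1 * f) m = (\<Sum>p \<in> {(0, m)}. mfps_nth 1 (fst p) * mfps_nth f (snd p))"
      unfolding times_mfps.rep_eq split_def
      by (rule sum.mono_neutral_right)
         (use finite_exponent_pairs[of m] in \<open>auto simp: one_mfps.rep_eq split_def\<close>)
    then show "mfps_nth (1 * f) m = mfps_nth f m" by (simp add: one_mfps.rep_eq)
  qed
  show "(f + g) * h = f * h + g * h"
    by (rule mfps_eqI)
       (simp add: times_mfps.rep_eq plus_mfps.rep_eq split_def sum.distrib distrib_right)
  show "(0 :: ('a, 'b) mfps) \<noteq> 1"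
  proof
    assume "(0 :: ('a, 'b) mfps) = 1"
    then have "mfps_nth (0 :: ('a, 'b) mfps) 0 = mfps_nth 1 0" by simp
    then show False by (simp add: zero_mfps.rep_eq one_mfps.rep_eq)
  qed
qed (rule mfps_eqI; simp add: plus_mfps.rep_eq zero_mfps.rep_eq minus_mfps.rep_eq
       uminus_mfps.rep_eq ac_simps)+

end

text \<open>
  No zero divisors: among the monomials of minimal total degree that occur in a series and only
  involve variables from a fixed finite set, take the smallest one lexicographically.
\<close>

definition mon_deg :: "('i \<Rightarrow>\<^sub>0 nat) \<Rightarrow> nat" where
  "mon_deg m = (\<Sum>i\<in>keys m. lookup m i)"

lemma mon_deg_superset: "finite K \<Longrightarrow> keys m \<subseteq> K \<Longrightarrow> mon_deg m = (\<Sum>i\<in>K. lookup m i)"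
  unfolding mon_deg_def by (rule sum.mono_neutral_left) (auto simp: in_keys_iff)

lemma keys_add_nat: "keys (a + b :: 'i \<Rightarrow>\<^sub>0 nat) = keys a \<union> keys b"
  by (auto simp: in_keys_iff lookup_add)

lemma mon_deg_add: "mon_deg (a + b) = mon_deg a + mon_deg b"
  by (simp add: mon_deg_superset[of "keys a \<union> keys b"] keys_add_nat lookup_add sum.distrib)

lemma lookup_le_mon_deg: "lookup m i \<le> mon_deg m"
proof (cases "i \<in> keys m")
  case True
  then show ?thesis unfolding mon_deg_def by (intro member_le_sum) simp_all
qed (simp add: in_keys_iff)

lemma finite_mon_deg: "finite K \<Longrightarrow> finite {m :: 'i \<Rightarrow>\<^sub>0 nat. keys m \<subseteq> K \<and> mon_deg m = d}" (is "_ \<Longrightarrow> finite ?A")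
proof -
  assume K: "finite K"
  let ?B = "{f. \<forall>i. (i \<in> K \<longrightarrow> f i \<in> {..d}) \<and> (i \<notin> K \<longrightarrow> f i = (0::nat))}"
  have "finite ?B" by (rule finite_set_of_finite_funs) (use K in auto)
  moreover have "lookup ` ?A \<subseteq> ?B"
  proof clarsimp
    fix m :: "'i \<Rightarrow>\<^sub>0 nat" and i
    assume "keys m \<subseteq> K" "d = mon_deg m"
    then show "(i \<in> K \<longrightarrow> lookup m i \<le> mon_deg m) \<and> (i \<notin> K \<longrightarrow> lookup m i = 0)"
      using lookup_le_mon_deg[of m i] by (auto simp flip: not_in_keys_iff_lookup_eq_zero)
  qed
  ultimately have "finite (lookup ` ?A)" by (rule rev_finite_subset)
  then show ?thesis by (rule finite_imageD) (simp add: inj_on_def lookup_inject)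
qed

instance mfps :: (linorder, idom) idom
proof
  fix f g :: "('a, 'b) mfps"
  assume f: "f \<noteq> 0" and g: "g \<noteq> 0"
  have min: "\<exists>m. mfps_nth h m \<noteq> 0 \<and> (\<forall>m'. mfps_nth h m' \<noteq> 0 \<longrightarrow> mon_deg m \<le> mon_deg m')"
    if "h \<noteq> 0" for h :: "('a, 'b) mfps"
  proof -
    have "\<exists>m. mfps_nth h m \<noteq> 0"
      using that mfps_eqI[of h 0] by (auto simp: zero_mfps.rep_eq)
    then obtain m where "mfps_nth h m \<noteq> 0" ..
    then show ?thesis by (rule ex_has_least_nat)
  qed
  obtain p where p: "mfps_nth f p \<noteq> 0" "\<And>m. mfps_nth f m \<noteq> 0 \<Longrightarrow> mon_deg p \<le> mon_deg m"
    using min[OF f] by blast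
  obtain q where q: "mfps_nth g q \<noteq> 0" "\<And>m. mfps_nth g m \<noteq> 0 \<Longrightarrow> mon_deg q \<le> mon_deg m"
    using min[OF g] by blast
  define K where "K = keys p \<union> keys q"
  define S where "S = {m. keys m \<subseteq> K \<and> mon_deg m = mon_deg p \<and> mfps_nth f m \<noteq> 0}"
  define T where "T = {m. keys m \<subseteq> K \<and> mon_deg m = mon_deg q \<and> mfps_nth g m \<noteq> 0}"
  have "finite K" by (simp add: K_def)
  then have S: "finite S" and T: "finite T"
    unfolding S_def T_def by (auto intro: finite_subset[OF _ finite_mon_deg])
  define s where "s = Min S"
  define t where "t = Min T"
  have "p \<in> S" "q \<in> T" using p q by (auto simp: S_def T_def K_def)
  then have sS: "s \<in> S" and tT: "t \<in> T"
    unfolding s_def t_def using S T by (auto intro: Min_in)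
  have s: "keys s \<subseteq> K" "mon_deg s = mon_deg p" "mfps_nth f s \<noteq> 0"
    using sS by (simp_all add: S_def)
  have t: "keys t \<subseteq> K" "mon_deg t = mon_deg q" "mfps_nth g t \<noteq> 0"
    using tT by (simp_all add: T_def)
  have zero: "mfps_nth f a * mfps_nth g b = 0" if eq: "a + b = s + t" and ne: "(a, b) \<noteq> (s, t)" for a b
  proof (rule ccontr)
    assume "mfps_nth f a * mfps_nth g b \<noteq> 0"
    then have nz: "mfps_nth f a \<noteq> 0" "mfps_nth g b \<noteq> 0" by simp_all
    have "keys a \<union> keys b = keys s \<union> keys t"
      using arg_cong[OF eq, of keys] by (simp only: keys_add_nat)
    then have k: "keys a \<subseteq> K" "keys b \<subseteq> K" using s(1) t(1) by blast+
    have "mon_deg a + mon_deg b = mon_deg p + mon_deg q"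
      using arg_cong[OF eq, of mon_deg] by (simp only: mon_deg_add s(2) t(2))
    then have "mon_deg a = mon_deg p" "mon_deg b = mon_deg q"
      using p(2)[OF nz(1)] q(2)[OF nz(2)] by linarith+
    then have "a \<in> S" "b \<in> T" using k nz by (simp_all add: S_def T_def)
    then have le: "s \<le> a" "t \<le> b" unfolding s_def t_def using S T by simp_all
    have "a = s"
    proof (rule ccontr)
      assume "a \<noteq> s"
      then have "s < a" using le(1) by (simp add: less_le)
      then have "s + t < a + b" using le(2) by (rule add_less_le_mono)
      then show False using eq by simp
    qed
    then show False using eq ne by simp
  qed
  have "mfps_nth (f * g) (s + t) = (\<Sum>x\<in>{(s, t)}. case x of (a, b) \<Rightarrow> mfps_nth f a * mfps_nth g b)"
    unfolding times_mfps.rep_eq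
  proof (rule sum.mono_neutral_right)
    show "finite {(a, b). a + b = s + t}" by (rule finite_exponent_pairs)
    show "\<forall>x\<in>{(a, b). a + b = s + t} - {(s, t)}. (case x of (a, b) \<Rightarrow> mfps_nth f a * mfps_nth g b) = 0"
    proof
      fix x
      assume x: "x \<in> {(a, b). a + b = s + t} - {(s, t)}"
      obtain a b where ab: "x = (a, b)" by (cases x)
      have "a + b = s + t" "(a, b) \<noteq> (s, t)" using x unfolding ab by simp_all
      then show "(case x of (a, b) \<Rightarrow> mfps_nth f a * mfps_nth g b) = 0"
        unfolding ab prod.case by (rule zero)
    qed
  qed simp
  then have "mfps_nth (f * g) (s + t) \<noteq> 0" using s(3) t(3) by simp
  then show "f * g \<noteq> 0" by (auto simp: zero_mfps.rep_eq)
qed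

lift_definition mfps_var :: "'i \<Rightarrow> ('i, 'a::zero_neq_one) mfps"
  is "\<lambda>i m. if m = Poly_Mapping.single i 1 then 1 else 0" .


section \<open>The base field\<close>

type_synonym 'k kV = "(posnat, 'k) mfps fract"

definition scal_var :: "posnat \<Rightarrow> 'k::field kV" where
  "scal_var i = Fract (mfps_var i) 1"

lemma scal_var_eq_iff: "(scal_var i :: 'k::field kV) = scal_var j \<longleftrightarrow> i = j"
proof
  assume "(scal_var i :: 'k kV) = scal_var j"
  then have "(mfps_var i :: (posnat, 'k) mfps) = mfps_var j"
    by (simp add: scal_var_def eq_fract)
  then have "mfps_nth (mfps_var i :: (posnat, 'k) mfps) (Poly_Mapping.single i 1)
      = mfps_nth (mfps_var j) (Poly_Mapping.single i 1)" by simp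
  then have "Poly_Mapping.single i (1::nat) = Poly_Mapping.single j 1"
    by (simp add: mfps_var.rep_eq split: if_splits)
  then have "lookup (Poly_Mapping.single i (1::nat)) i = lookup (Poly_Mapping.single j 1) i" by simp
  then show "i = j" by (simp add: lookup_single when_def split: if_splits)
qed simp


section \<open>Free modules and linear extension\<close>

text \<open>The free module over \<open>'k\<close> on a basis \<open>'a\<close> is the type \<open>'a \<Rightarrow>\<^sub>0 'k\<close>.\<close>

definition smul :: "'k::semiring_0 \<Rightarrow> ('a \<Rightarrow>\<^sub>0 'k) \<Rightarrow> ('a \<Rightarrow>\<^sub>0 'k)" where
  "smul c h = Poly_Mapping.map ((*) c) h"

definition lin_ext :: "('a \<Rightarrow> 'b \<Rightarrow>\<^sub>0 'k) \<Rightarrow> ('a \<Rightarrow>\<^sub>0 'k::semiring_0) \<Rightarrow> ('b \<Rightarrow>\<^sub>0 'k)" where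
  "lin_ext g h = (\<Sum>a\<in>keys h. smul (lookup h a) (g a))"

definition bilin_ext ::
  "('a \<Rightarrow> 'b \<Rightarrow> 'c \<Rightarrow>\<^sub>0 'k) \<Rightarrow> ('a \<Rightarrow>\<^sub>0 'k::semiring_0) \<Rightarrow> ('b \<Rightarrow>\<^sub>0 'k) \<Rightarrow> ('c \<Rightarrow>\<^sub>0 'k)" where
  "bilin_ext g h h' = lin_ext (\<lambda>a. lin_ext (g a) h') h"

definition prepend :: "'a \<Rightarrow> ('a list \<Rightarrow>\<^sub>0 'k::semiring_1) \<Rightarrow> ('a list \<Rightarrow>\<^sub>0 'k)" where
  "prepend x = lin_ext (\<lambda>w. Poly_Mapping.single (x # w) 1)"

definition deconc :: "'a list \<Rightarrow> ('a list \<times> 'a list) \<Rightarrow>\<^sub>0 'k::semiring_1" where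
  "deconc w = (\<Sum>j\<le>length w. Poly_Mapping.single (take j w, drop j w) 1)"

lemma lookup_smul: "lookup (smul c h) x = c * lookup h x"
  by (simp add: smul_def Poly_Mapping.map.rep_eq when_def)

lemma keys_smul: "keys (smul c h) \<subseteq> keys h"
  by (auto simp: in_keys_iff lookup_smul)

lemma keys_lin_ext: "keys (lin_ext g h) \<subseteq> (\<Union>a\<in>keys h. keys (g a))"
proof -
  have "keys (lin_ext g h) \<subseteq> (\<Union>a\<in>keys h. keys (smul (lookup h a) (g a)))"
    unfolding lin_ext_def by (rule keys_sum)
  also have "\<dots> \<subseteq> (\<Union>a\<in>keys h. keys (g a))"
    by (intro UN_mono order_refl keys_smul)
  finally show ?thesis .
qed

lemma keys_prepend: "keys (prepend x h) \<subseteq> (#) x ` keys h"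
  unfolding prepend_def using keys_lin_ext[of "\<lambda>w. Poly_Mapping.single (x # w) 1" h]
  by (auto split: if_splits)

lemma lookup_deconc: "lookup (deconc w :: _ \<Rightarrow>\<^sub>0 'k::semiring_1) (u, v) = (if w = u @ v then 1 else 0)"
proof -
  have "lookup (deconc w :: _ \<Rightarrow>\<^sub>0 'k) (u, v)
      = (\<Sum>j\<le>length w. if take j w = u \<and> drop j w = v then 1 else 0)"
    by (simp add: deconc_def lookup_sum lookup_single when_def)
  also have "\<dots> = (\<Sum>j\<le>length w. if j = length u then (if w = u @ v then 1 else 0) else 0)"
  proof (rule sum.cong)
    fix j
    assume "j \<in> {..length w}"
    then have "take j w = u \<and> drop j w = v \<longleftrightarrow> j = length u \<and> w = u @ v"
      by (metis append_eq_conv_conj append_take_drop_id atMost_iff length_take min.absorb2)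
    then show "(if take j w = u \<and> drop j w = v then 1 else 0)
        = (if j = length u then (if w = u @ v then 1 else 0) else (0 :: 'k))"
      by auto
  qed simp
  also have "\<dots> = (if w = u @ v then 1 else 0)"
    by auto
  finally show ?thesis .
qed


section \<open>Generic and completed bialgebras on words, regularizing maps\<close>

text \<open>
  A generic bialgebra on words: its underlying space is a subspace \<open>gcarrier\<close> of the free module on
  words, and the values of \<open>gmult\<close> are only meaningful on pairs in generic position.
\<close>

record (overloaded) ('a, 'k) generic_bialg =
  gcarrier :: "('a list \<Rightarrow>\<^sub>0 'k) set"
  gpos :: "('a list \<Rightarrow>\<^sub>0 'k) \<Rightarrow> ('a list \<Rightarrow>\<^sub>0 'k) \<Rightarrow> bool"
  gunit :: "'a list \<Rightarrow>\<^sub>0 'k"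
  gmult :: "('a list \<Rightarrow>\<^sub>0 'k) \<Rightarrow> ('a list \<Rightarrow>\<^sub>0 'k) \<Rightarrow> ('a list \<Rightarrow>\<^sub>0 'k)"
  gcomult :: "('a list \<Rightarrow>\<^sub>0 'k) \<Rightarrow> ('a list \<times> 'a list \<Rightarrow>\<^sub>0 'k)"

text \<open>
  A completed bialgebra on words: its elements are the possibly infinite combinations of words, given
  by their coefficients. Elements of the completed tensor square are the possibly infinite
  combinations of pairs of words.
\<close>

record ('b, 'k) completed_bialg =
  cunit :: "'b list \<Rightarrow> 'k"
  cmult :: "('b list \<Rightarrow> 'k) \<Rightarrow> ('b list \<Rightarrow> 'k) \<Rightarrow> ('b list \<Rightarrow> 'k)"
  ccomult :: "('b list \<Rightarrow> 'k) \<Rightarrow> ('b list \<times> 'b list \<Rightarrow> 'k)"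

definition ctensor :: "('b \<Rightarrow> 'k) \<Rightarrow> ('c \<Rightarrow> 'k) \<Rightarrow> ('b \<times> 'c \<Rightarrow> 'k::times)" where
  "ctensor F G = (\<lambda>(u, v). F u * G v)"

text \<open>The map \<open>f \<otimes> f\<close>, for linear \<open>f\<close>, into the completed tensor square.\<close>

definition tensor_map ::
  "(('a \<Rightarrow>\<^sub>0 'k) \<Rightarrow> 'b \<Rightarrow> 'k) \<Rightarrow> ('a \<times> 'a \<Rightarrow>\<^sub>0 'k::semiring_1) \<Rightarrow> ('b \<times> 'b \<Rightarrow> 'k)" where
  "tensor_map f t = (\<lambda>p. \<Sum>(x, y)\<in>keys t. lookup t (x, y) *
     ctensor (f (Poly_Mapping.single x 1)) (f (Poly_Mapping.single y 1)) p)"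

definition regularizing_bialgebra_map ::
  "('a, 'k) generic_bialg \<Rightarrow> ('b, 'k::field) completed_bialg \<Rightarrow>
   (('a list \<Rightarrow>\<^sub>0 'k) \<Rightarrow> 'b list \<Rightarrow> 'k) \<Rightarrow> bool" where
  "regularizing_bialgebra_map H H' f \<longleftrightarrow>
     (\<forall>h\<in>gcarrier H. \<forall>h'\<in>gcarrier H. f (h + h') = (\<lambda>w. f h w + f h' w)) \<and>
     (\<forall>c. \<forall>h\<in>gcarrier H. f (smul c h) = (\<lambda>w. c * f h w)) \<and>
     (\<forall>r. \<forall>h\<in>gcarrier H. (\<forall>u\<in>keys h. length u = r) \<longrightarrow> (\<forall>w. f h w \<noteq> 0 \<longrightarrow> length w = r)) \<and>
     f (gunit H) = cunit H' \<and>
     (\<forall>h\<in>gcarrier H. \<forall>h'\<in>gcarrier H. gpos H h h' \<longrightarrow> f (gmult H h h') = cmult H' (f h) (f h')) \<and>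
     (\<forall>h\<in>gcarrier H. tensor_map f (gcomult H h) = ccomult H' (f h))"


section \<open>The generic divided quasi-shuffle bialgebra\<close>

text \<open>The letter \<open>v\<^sub>i\<close> is represented by its index \<open>i\<close>, the scalar \<open>v\<^sub>i\<close> by \<^term>\<open>scal_var i\<close>.\<close>

definition generic_words :: "posnat list set" where
  "generic_words = {w. distinct w}"

definition generic_space :: "(posnat list \<Rightarrow>\<^sub>0 'k::field kV) set" where
  "generic_space = {h. keys h \<subseteq> generic_words}"

definition generic_position_words :: "posnat list \<Rightarrow> posnat list \<Rightarrow> bool" where
  "generic_position_words u v \<longleftrightarrow> set u \<inter> set v = {}"

definition generic_position ::
  "(posnat list \<Rightarrow>\<^sub>0 'k::field kV) \<Rightarrow> (posnat list \<Rightarrow>\<^sub>0 'k kV) \<Rightarrow> bool" where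
  "generic_position h h' \<longleftrightarrow> (\<forall>u\<in>keys h. \<forall>v\<in>keys h'. generic_position_words u v)"

fun dqsh :: "posnat list \<Rightarrow> posnat list \<Rightarrow> (posnat list \<Rightarrow>\<^sub>0 'k::field kV)" where
  "dqsh [] v = Poly_Mapping.single v 1"
| "dqsh (i # u) [] = Poly_Mapping.single (i # u) 1"
| "dqsh (i # u) (j # v) =
     prepend i (dqsh u (j # v)) + prepend j (dqsh (i # u) v) +
     smul (1 / (scal_var i - scal_var j)) (prepend i (dqsh u v) - prepend j (dqsh u v))"

lemma keys_dqsh:
  assumes "distinct u" "distinct v" "generic_position_words u v"
    and "w \<in> keys (dqsh u v :: _ \<Rightarrow>\<^sub>0 'k::field kV)"
  shows "distinct w \<and> set w \<subseteq> set u \<union> set v"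
  using assms
proof (induction u v arbitrary: w rule: dqsh.induct)
  case (3 i u j v)
  let ?k = "keys :: (_ \<Rightarrow>\<^sub>0 'k kV) \<Rightarrow> _"
  have "w \<in> ?k (prepend i (dqsh u (j # v))) \<union> ?k (prepend j (dqsh (i # u) v)) \<union>
      (?k (prepend i (dqsh u v)) \<union> ?k (prepend j (dqsh u v)))"
    using "3.prems"(4) by (auto simp: in_keys_iff lookup_add lookup_smul lookup_minus)
  then consider
      w' where "w = i # w'" "w' \<in> ?k (dqsh u (j # v))"
    | w' where "w = j # w'" "w' \<in> ?k (dqsh (i # u) v)"
    | w' where "w = i # w'" "w' \<in> ?k (dqsh u v)"
    | w' where "w = j # w'" "w' \<in> ?k (dqsh u v)"
    by (blast dest: subsetD[OF keys_prepend])
  then show ?case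
  proof cases
    case 1
    have "distinct w' \<and> set w' \<subseteq> set u \<union> set (j # v)"
      by (rule "3.IH"(1)) (use "3.prems" 1 in \<open>auto simp: generic_position_words_def\<close>)
    then show ?thesis using "3.prems" 1 by (auto simp: generic_position_words_def)
  next
    case 2
    have "distinct w' \<and> set w' \<subseteq> set (i # u) \<union> set v"
      by (rule "3.IH"(2)) (use "3.prems" 2 in \<open>auto simp: generic_position_words_def\<close>)
    then show ?thesis using "3.prems" 2 by (auto simp: generic_position_words_def)
  next
    case 3
    have "distinct w' \<and> set w' \<subseteq> set u \<union> set v"
      by (rule "3.IH"(3)) (use "3.prems" 3 in \<open>auto simp: generic_position_words_def\<close>)
    then show ?thesis using "3.prems" 3 by (auto simp: generic_position_words_def)
  next
    case 4
    have "distinct w' \<and> set w' \<subseteq> set u \<union> set v"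
      by (rule "3.IH"(3)) (use "3.prems" 4 in \<open>auto simp: generic_position_words_def\<close>)
    then show ?thesis using "3.prems" 4 by (auto simp: generic_position_words_def)
  qed
qed auto

definition QSh_gd :: "(posnat, 'k::field kV) generic_bialg" where
  "QSh_gd = \<lparr>
     gcarrier = generic_space,
     gpos = generic_position,
     gunit = Poly_Mapping.single [] 1,
     gmult = bilin_ext dqsh,
     gcomult = lin_ext deconc \<rparr>"

lemma dqsh_closed:
  fixes h h' :: "posnat list \<Rightarrow>\<^sub>0 'k::field kV"
  assumes "h \<in> generic_space" "h' \<in> generic_space" "generic_position h h'"
  shows "bilin_ext dqsh h h' \<in> generic_space"
proof -
  have "keys (bilin_ext dqsh h h') \<subseteq> (\<Union>u\<in>keys h. \<Union>v\<in>keys h'. keys (dqsh u v :: _ \<Rightarrow>\<^sub>0 'k kV))"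
    unfolding bilin_ext_def
    by (rule order_trans[OF keys_lin_ext]) (rule UN_mono[OF order_refl keys_lin_ext])
  then show ?thesis
    using assms unfolding generic_space_def generic_words_def generic_position_def
    by (blast dest: keys_dqsh)
qed


section \<open>Completed quasi-symmetric functions\<close>

fun qsh :: "posnat list \<Rightarrow> posnat list \<Rightarrow> (posnat list \<Rightarrow>\<^sub>0 'k::comm_ring_1)" where
  "qsh [] v = Poly_Mapping.single v 1"
| "qsh (n # u) [] = Poly_Mapping.single (n # u) 1"
| "qsh (n # u) (m # v) =
     prepend n (qsh u (m # v)) + prepend m (qsh (n # u) v) + prepend (n + m) (qsh u v)"

definition weight :: "posnat list \<Rightarrow> nat" where
  "weight w = sum_list (map nat_of w)"

text \<open>
  Product and coproduct are homogeneous for the weight, so they extend to the completion: the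
  component of weight \<open>n\<close> (of weight \<open>(p, q)\<close> for the coproduct) of the result is computed from the
  finitely many words of total weight \<open>n\<close> (of weight \<open>p + q\<close>).
\<close>

definition QSym_V :: "(posnat, 'k::field kV) completed_bialg" where
  "QSym_V = \<lparr>
     cunit = (\<lambda>w. if w = [] then 1 else 0),
     cmult = (\<lambda>F G w. \<Sum>(u, v) | weight u + weight v = weight w. F u * G v * lookup (qsh u v) w),
     ccomult = (\<lambda>F (u, v). \<Sum>w | weight w = weight u + weight v. F w * lookup (deconc w) (u, v)) \<rparr>"

lemma weight_append: "weight (u @ v) = weight u + weight v"
  by (simp add: weight_def)

lemma nat_of_pos: "0 < nat_of n"
  using nat_of by auto

lemma finite_nat_of_le: "finite {a. nat_of a \<le> n}"
  by (rule finite_imageD[where f = nat_of])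
     (auto intro: finite_subset[of _ "{..n}"] inj_onI simp: nat_of_inject)

lemma finite_weight_le: "finite {w. weight w \<le> n}"
proof -
  have le: "set w \<subseteq> {a. nat_of a \<le> weight w} \<and> length w \<le> weight w" for w
  proof (induction w)
    case (Cons a w)
    then show ?case using nat_of_pos[of a] by (fastforce simp: weight_def)
  qed (simp add: weight_def)
  have "{w. weight w \<le> n} \<subseteq> {w. set w \<subseteq> {a. nat_of a \<le> n} \<and> length w \<le> n}"
  proof clarify
    fix w
    assume "weight w \<le> n"
    then show "set w \<subseteq> {a. nat_of a \<le> n} \<and> length w \<le> n"
      using le[of w] by (auto intro: order_trans)
  qed
  then show ?thesis
    by (rule finite_subset) (rule finite_lists_length_le[OF finite_nat_of_le])
qed

lemma finite_weight: "finite {w. weight w = n}"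
  by (rule finite_subset[OF _ finite_weight_le[of n]]) auto

lemma finite_weight_pairs: "finite {(u, v). weight u + weight v = n}"
  by (rule finite_subset[OF _ finite_cartesian_product[OF finite_weight_le finite_weight_le], of _ n n])
     auto

lemma weight_qsh: "w \<in> keys (qsh u v :: _ \<Rightarrow>\<^sub>0 'k::comm_ring_1) \<Longrightarrow> weight w = weight u + weight v"
proof (induction u v arbitrary: w rule: qsh.induct)
  case (3 n u m v)
  let ?k = "keys :: (_ \<Rightarrow>\<^sub>0 'k) \<Rightarrow> _"
  have "w \<in> ?k (prepend n (qsh u (m # v))) \<union> ?k (prepend m (qsh (n # u) v)) \<union>
      ?k (prepend (n + m) (qsh u v))"
    using "3.prems" by (auto simp: in_keys_iff lookup_add)
  then consider
      w' where "w = n # w'" "w' \<in> ?k (qsh u (m # v))"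
    | w' where "w = m # w'" "w' \<in> ?k (qsh (n # u) v)"
    | w' where "w = (n + m) # w'" "w' \<in> ?k (qsh u v)"
    by (blast dest: subsetD[OF keys_prepend])
  then show ?case
    using "3.IH" by cases (fastforce simp: weight_def plus_posnat.rep_eq)+
qed (auto simp: weight_def split: if_splits)

lemma ccomult_QSym_V: "ccomult QSym_V F (u, v) = F (u @ v)"
proof -
  have "ccomult QSym_V F (u, v)
      = (\<Sum>w | weight w = weight u + weight v. if w = u @ v then F w else 0)"
    by (auto simp: QSym_V_def lookup_deconc intro!: sum.cong)
  then show ?thesis by (simp add: finite_weight weight_append)
qed


section \<open>The map gamma\<close>

text \<open>
  The coefficient of \<open>[n\<^sub>1\<dots>n\<^sub>r]\<close> in the image of \<open>[v\<^bsub>i\<^sub>1\<^esub>\<dots>v\<^bsub>i\<^sub>r\<^esub>]\<close>; for \<open>r = 0\<close> the product is empty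
  and the image is the empty word.
\<close>

definition gamma_word :: "posnat list \<Rightarrow> posnat list \<Rightarrow> 'k::field kV" where
  "gamma_word is ns =
     (if length ns = length is
      then \<Prod>j<length is. scal_var (is ! j) ^ (nat_of (ns ! j) - 1) else 0)"

definition gamma :: "(posnat list \<Rightarrow>\<^sub>0 'k::field kV) \<Rightarrow> posnat list \<Rightarrow> 'k kV" where
  "gamma h = (\<lambda>w. \<Sum>u\<in>keys h. lookup h u * gamma_word u w)"

lemma gamma_single: "gamma (Poly_Mapping.single u 1) = gamma_word u"
  by (simp add: gamma_def fun_eq_iff)

lemma gamma_word_Nil: "gamma_word [] w = (if w = [] then 1 else 0)"
  by (simp add: gamma_word_def)

end

theory Submission
  imports Defs
begin

text \<open>
  The map \<open>\<gamma>\<close> sends a word to the product, letter by letter, of the geometric series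
  \<open>\<Sum>\<^sub>n v\<^sub>i\<^sup>n\<^sup>-\<^sup>1 [n]\<close>. Linearity and compatibility with length, unit and deconcatenation are then
  immediate: the coefficient of \<open>\<gamma>\<close> at a concatenation splits as a product.

  For the product, call \<open>F(p \<sqdot>)\<close> the series obtained from \<open>F\<close> by stripping an initial letter \<open>p\<close>.
  Stripping acts on the quasi-shuffle product almost as a derivation,
  \<open>(F \<star> G)(p \<sqdot>) = F(p \<sqdot>) \<star> G + F \<star> G(p \<sqdot>) + \<Sum>\<^bsub>n+m=p\<^esub> F(n \<sqdot>) \<star> G(m \<sqdot>)\<close>
  (lemma \<open>cmult_Cons\<close>), and it acts on \<open>\<gamma>\<close> by a scalar:
  \<open>\<gamma>([v\<^sub>i u])(p \<sqdot>) = v\<^sub>i\<^sup>p\<^sup>-\<^sup>1 \<gamma>(u)\<close>. Hence, by induction, the first two terms match the first two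
  terms of the recursion for the generic product, while the third one acquires the scalar
  \<open>\<Sum>\<^bsub>n+m=p\<^esub> v\<^sub>i\<^sup>n\<^sup>-\<^sup>1 v\<^sub>j\<^sup>m\<^sup>-\<^sup>1 = (v\<^sub>i\<^sup>p\<^sup>-\<^sup>1 - v\<^sub>j\<^sup>p\<^sup>-\<^sup>1) / (v\<^sub>i - v\<^sub>j)\<close>
  (lemma \<open>sum_splittings_powers\<close>), a finite geometric sum: this is where the divided difference
  in the generic product comes from. Generic position is what makes \<open>v\<^sub>i - v\<^sub>j\<close> invertible.
\<close>

section \<open>Linear functionals on free modules\<close>

definition lin_eval :: "('a \<Rightarrow> 'k::comm_ring_1) \<Rightarrow> ('a \<Rightarrow>\<^sub>0 'k) \<Rightarrow> 'k" where
  "lin_eval \<phi> h = (\<Sum>a\<in>keys h. lookup h a * \<phi> a)"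

lemma lin_eval_superset:
  "finite K \<Longrightarrow> keys h \<subseteq> K \<Longrightarrow> lin_eval \<phi> h = (\<Sum>a\<in>K. lookup h a * \<phi> a)"
  unfolding lin_eval_def by (rule sum.mono_neutral_left) (auto simp: in_keys_iff)

lemma lin_eval_0 [simp]: "lin_eval \<phi> 0 = 0"
  by (simp add: lin_eval_def)

lemma lin_eval_single [simp]: "lin_eval \<phi> (Poly_Mapping.single a c) = c * \<phi> a"
  by (simp add: lin_eval_superset[of "{a}"])

lemma lin_eval_add: "lin_eval \<phi> (g + h) = lin_eval \<phi> g + lin_eval \<phi> h"
  using keys_add[of g h]
  by (simp add: lin_eval_superset[of "keys g \<union> keys h"] lookup_add distrib_right sum.distrib)

lemma lin_eval_smul: "lin_eval \<phi> (smul c h) = c * lin_eval \<phi> h"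
  by (simp add: lin_eval_superset[of "keys h" "smul c h"] keys_smul lookup_smul
      lin_eval_superset[of "keys h" h] sum_distrib_left mult.assoc)

lemma lin_eval_diff: "lin_eval \<phi> (g - h) = lin_eval \<phi> g - lin_eval \<phi> h"
  using lin_eval_add[of \<phi> "g - h" h] by simp

lemma lin_eval_sum: "lin_eval \<phi> (\<Sum>a\<in>A. g a) = (\<Sum>a\<in>A. lin_eval \<phi> (g a))"
  by (induction A rule: infinite_finite_induct) (simp_all add: lin_eval_add)

lemma lin_eval_lin_ext: "lin_eval \<phi> (lin_ext g h) = lin_eval (\<lambda>a. lin_eval \<phi> (g a)) h"
  by (simp add: lin_ext_def lin_eval_sum lin_eval_smul) (simp add: lin_eval_def)

lemma lin_eval_prepend: "lin_eval \<phi> (prepend x h) = lin_eval (\<lambda>w. \<phi> (x # w)) h"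
  by (simp add: prepend_def lin_eval_lin_ext)

lemma lin_eval_deconc:
  "lin_eval \<phi> (deconc w) = (\<Sum>j\<le>length w. \<phi> (take j w, drop j w))"
  by (simp add: deconc_def lin_eval_sum)

lemma lin_eval_cong: "(\<And>a. a \<in> keys h \<Longrightarrow> \<phi> a = \<psi> a) \<Longrightarrow> lin_eval \<phi> h = lin_eval \<psi> h"
  unfolding lin_eval_def by (rule sum.cong) simp_all

lemma lin_eval_scale: "lin_eval (\<lambda>a. c * \<phi> a) h = c * lin_eval \<phi> h"
  by (simp add: lin_eval_def sum_distrib_left mult.left_commute)

lemma lookup_eq_lin_eval: "lookup h x = lin_eval (\<lambda>a. if a = x then 1 else 0) h"
  by (simp add: lin_eval_superset[of "insert x (keys h)"] if_distrib[of "(*) _"] subset_insertI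
      cong: if_cong)

lemma lookup_prepend_Cons:
  "lookup (prepend x h) (y # w) = (if x = y then lookup h w else (0 :: 'k::comm_ring_1))"
  by (simp add: lookup_eq_lin_eval[of _ w] lookup_eq_lin_eval[of _ "y # w"] lin_eval_prepend)
     (simp add: lin_eval_def)


section \<open>Stripping the first letter of a completed quasi-shuffle product\<close>

lemma cmult_QSym_V:
  "cmult QSym_V F G w = (\<Sum>(a, b) | weight a + weight b = weight w. F a * G b * lookup (qsh a b) w)"
  by (simp add: QSym_V_def)

lemma qsh_Nil_right: "qsh u [] = Poly_Mapping.single u 1"
  by (cases u) simp_all

lemma weight_Nil [simp]: "weight [] = 0"
  by (simp add: weight_def)

lemma weight_Cons [simp]: "weight (n # w) = nat_of n + weight w"
  by (simp add: weight_def)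

lemma weight_eq_0_iff [simp]: "weight w = 0 \<longleftrightarrow> w = []"
  using nat_of_pos by (cases w) auto

lemma cmult_Nil: "cmult QSym_V F G [] = F [] * G []"
proof -
  have "{(a, b). weight a + weight b = weight []} = {([], [])}"
    by auto
  then show ?thesis
    by (simp add: cmult_QSym_V)
qed

lemma cmult_unit_left:
  "cmult QSym_V (\<lambda>w. if w = [] then 1 else 0) G = (G :: posnat list \<Rightarrow> 'k::field kV)"
proof
  fix w
  have "cmult QSym_V (\<lambda>w. if w = [] then 1 else 0) G w
      = (\<Sum>(a, b)\<in>{([], w)}. (if a = [] then 1 else 0) * G b * lookup (qsh a b) w)"
    unfolding cmult_QSym_V
    by (rule sum.mono_neutral_right)
       (auto simp: finite_weight_pairs lookup_single when_def split: if_splits)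
  then show "cmult QSym_V (\<lambda>w. if w = [] then 1 else 0) G w = G w"
    by simp
qed

lemma cmult_unit_right:
  "cmult QSym_V F (\<lambda>w. if w = [] then 1 else 0) = (F :: posnat list \<Rightarrow> 'k::field kV)"
proof
  fix w
  have "cmult QSym_V F (\<lambda>w. if w = [] then 1 else 0) w
      = (\<Sum>(a, b)\<in>{(w, [])}. F a * (if b = [] then 1 else 0) * lookup (qsh a b) w)"
    unfolding cmult_QSym_V
    by (rule sum.mono_neutral_right)
       (auto simp: finite_weight_pairs qsh_Nil_right lookup_single when_def split: if_splits)
  then show "cmult QSym_V F (\<lambda>w. if w = [] then 1 else 0) w = F w"
    by (simp add: qsh_Nil_right)
qed

text \<open>
  At the level of coefficients an empty factor satisfies the same three-term recursion, with
  vanishing terms; the sum over all pairs of words can thus be split into three without treating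
  empty words apart.
\<close>

lemma lookup_qsh_Cons:
  "lookup (qsh a b :: _ \<Rightarrow>\<^sub>0 'k::comm_ring_1) (p # w) =
     (if a \<noteq> [] \<and> hd a = p then lookup (qsh (tl a) b) w else 0) +
     (if b \<noteq> [] \<and> hd b = p then lookup (qsh a (tl b)) w else 0) +
     (if a \<noteq> [] \<and> b \<noteq> [] \<and> hd a + hd b = p then lookup (qsh (tl a) (tl b)) w else 0)"
  by (cases a; cases b)
     (auto simp: lookup_add lookup_prepend_Cons qsh_Nil_right lookup_single when_def)

text \<open>
  Each of the three terms of the quasi-shuffle recursion is supported on the pairs \<open>(a, b)\<close> whose
  first letters produce \<open>p\<close>; removing these letters is a bijection onto the pairs that are summed
  over on the right.
\<close>

lemma cmult_Cons:
  fixes F G :: "posnat list \<Rightarrow> 'k::field kV"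
  shows "cmult QSym_V F G (p # w) =
     cmult QSym_V (\<lambda>a. F (p # a)) G w + cmult QSym_V F (\<lambda>b. G (p # b)) w +
     (\<Sum>(n, m) | n + m = p. cmult QSym_V (\<lambda>a. F (n # a)) (\<lambda>b. G (m # b)) w)"
proof -
  let ?S = "\<lambda>N. {(a, b). weight a + weight b = N}"
  let ?P = "{(n, m). n + m = p}"
  let ?N = "weight (p # w)"
  have "(\<Sum>(a, b)\<in>?S ?N. F a * G b *
        (if a \<noteq> [] \<and> hd a = p then lookup (qsh (tl a) b) w else 0))
      = (\<Sum>(a, b) | weight a + weight b = ?N \<and> a \<noteq> [] \<and> hd a = p.
          F a * G b * lookup (qsh (tl a) b) w)"
    by (rule sum.mono_neutral_cong_right) (auto simp: finite_weight_pairs split: if_splits)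
  also have "\<dots> = cmult QSym_V (\<lambda>a. F (p # a)) G w"
    unfolding cmult_QSym_V
    by (rule sum.reindex_bij_witness[where j = "\<lambda>(a, b). (tl a, b)"
          and i = "\<lambda>(a, b). (p # a, b)"])
       (auto simp: neq_Nil_conv plus_posnat.rep_eq)
  finally have left: "(\<Sum>(a, b)\<in>?S ?N. F a * G b *
        (if a \<noteq> [] \<and> hd a = p then lookup (qsh (tl a) b) w else 0))
      = cmult QSym_V (\<lambda>a. F (p # a)) G w" .
  have "(\<Sum>(a, b)\<in>?S ?N. F a * G b *
        (if b \<noteq> [] \<and> hd b = p then lookup (qsh a (tl b)) w else 0))
      = (\<Sum>(a, b) | weight a + weight b = ?N \<and> b \<noteq> [] \<and> hd b = p.
          F a * G b * lookup (qsh a (tl b)) w)"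
    by (rule sum.mono_neutral_cong_right) (auto simp: finite_weight_pairs split: if_splits)
  also have "\<dots> = cmult QSym_V F (\<lambda>b. G (p # b)) w"
    unfolding cmult_QSym_V
    by (rule sum.reindex_bij_witness[where j = "\<lambda>(a, b). (a, tl b)"
          and i = "\<lambda>(a, b). (a, p # b)"])
       (auto simp: neq_Nil_conv plus_posnat.rep_eq)
  finally have right: "(\<Sum>(a, b)\<in>?S ?N. F a * G b *
        (if b \<noteq> [] \<and> hd b = p then lookup (qsh a (tl b)) w else 0))
      = cmult QSym_V F (\<lambda>b. G (p # b)) w" .
  have "(\<Sum>(a, b)\<in>?S ?N. F a * G b *
        (if a \<noteq> [] \<and> b \<noteq> [] \<and> hd a + hd b = p then lookup (qsh (tl a) (tl b)) w else 0))
      = (\<Sum>(a, b) | weight a + weight b = ?N \<and> a \<noteq> [] \<and> b \<noteq> [] \<and> hd a + hd b = p.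
          F a * G b * lookup (qsh (tl a) (tl b)) w)"
    by (rule sum.mono_neutral_cong_right) (auto simp: finite_weight_pairs split: if_splits)
  also have "\<dots> = (\<Sum>((n, m), (a, b))\<in>?P \<times> ?S (weight w). F (n # a) * G (m # b) * lookup (qsh a b) w)"
    by (rule sum.reindex_bij_witness[where j = "\<lambda>(a, b). ((hd a, hd b), (tl a, tl b))"
          and i = "\<lambda>((n, m), (a, b)). (n # a, m # b)"])
       (auto simp: neq_Nil_conv plus_posnat.rep_eq)
  also have "\<dots> = (\<Sum>(n, m)\<in>?P. cmult QSym_V (\<lambda>a. F (n # a)) (\<lambda>b. G (m # b)) w)"
    by (simp add: cmult_QSym_V sum.cartesian_product' split_def)
  finally have both: "(\<Sum>(a, b)\<in>?S ?N. F a * G b *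
        (if a \<noteq> [] \<and> b \<noteq> [] \<and> hd a + hd b = p then lookup (qsh (tl a) (tl b)) w else 0))
      = (\<Sum>(n, m)\<in>?P. cmult QSym_V (\<lambda>a. F (n # a)) (\<lambda>b. G (m # b)) w)" .
  show ?thesis
    unfolding left[symmetric] right[symmetric] both[symmetric]
    unfolding cmult_QSym_V lookup_qsh_Cons
    by (simp only: split_def distrib_left sum.distrib)
qed

lemma cmult_scale:
  fixes F G :: "posnat list \<Rightarrow> 'k::field kV"
  shows "cmult QSym_V (\<lambda>a. c * F a) G w = c * cmult QSym_V F G w"
    and "cmult QSym_V F (\<lambda>b. c * G b) w = c * cmult QSym_V F G w"
  by (simp_all add: cmult_QSym_V sum_distrib_left split_def ac_simps)

lemma cmult_lin_eval:
  fixes h :: "'a \<Rightarrow>\<^sub>0 'k::field kV" and h' :: "'b \<Rightarrow>\<^sub>0 'k kV"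
  shows "cmult QSym_V (\<lambda>a. lin_eval (\<lambda>u. F u a) h) (\<lambda>b. lin_eval (\<lambda>v. G v b) h') w
       = lin_eval (\<lambda>u. lin_eval (\<lambda>v. cmult QSym_V (F u) (G v) w) h') h"
proof -
  have left: "cmult QSym_V (\<lambda>a. lin_eval (\<lambda>u. F u a) h) H w
      = lin_eval (\<lambda>u. cmult QSym_V (F u) H w) h" for H
    unfolding cmult_QSym_V lin_eval_def split_def sum_distrib_right sum_distrib_left
    by (subst sum.swap) (simp add: mult.assoc)
  have right: "cmult QSym_V H (\<lambda>b. lin_eval (\<lambda>v. G v b) h') w
      = lin_eval (\<lambda>v. cmult QSym_V H (G v) w) h'" for H
    unfolding cmult_QSym_V lin_eval_def split_def sum_distrib_right sum_distrib_left
    by (subst sum.swap) (simp add: mult_ac)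
  show ?thesis
    by (simp add: left right)
qed


section \<open>Coefficients of gamma\<close>

lemma gamma_eq_lin_eval: "gamma h w = lin_eval (\<lambda>u. gamma_word u w) h"
  by (simp add: gamma_def lin_eval_def)

lemma gamma_word_Cons_Nil: "gamma_word (i # u) [] = 0"
  by (simp add: gamma_word_def)

lemma gamma_word_Cons_Cons:
  "gamma_word (i # u) (n # w) = scal_var i ^ (nat_of n - 1) * gamma_word u w"
  by (simp add: gamma_word_def prod.lessThan_Suc_shift del: prod.lessThan_Suc)

lemma gamma_word_append:
  "length x = length a \<Longrightarrow> gamma_word (x @ y) (a @ b) = gamma_word x a * gamma_word y b"
  by (induction x a rule: list_induct2)
     (simp_all add: gamma_word_Nil gamma_word_Cons_Cons mult.assoc)

lemma gamma_word_length: "length w \<noteq> length u \<Longrightarrow> gamma_word u w = 0"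
  by (simp add: gamma_word_def)

text \<open>Only the cut of \<open>u\<close> at the length of \<open>a\<close> contributes to the coefficient at \<open>a \<otimes> b\<close>.\<close>

lemma gamma_word_deconc:
  "(\<Sum>j\<le>length u. gamma_word (take j u) a * gamma_word (drop j u) b)
     = (gamma_word u (a @ b) :: 'k::field kV)"
proof (cases "length a \<le> length u")
  case True
  have "(\<Sum>j\<le>length u. gamma_word (take j u) a * gamma_word (drop j u) b)
      = (\<Sum>j\<in>{length a}. gamma_word (take j u) a * gamma_word (drop j u) b :: 'k kV)"
    by (rule sum.mono_neutral_right) (use True in \<open>auto simp: gamma_word_length\<close>)
  also have "\<dots> = gamma_word (take (length a) u @ drop (length a) u) (a @ b)"
    using True by (subst gamma_word_append) simp_all
  finally show ?thesis
    by simp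
next
  case False
  have "(gamma_word u (a @ b) :: 'k kV) = 0"
    using False by (simp add: gamma_word_length)
  moreover have "gamma_word (take j u) a * gamma_word (drop j u) b = (0 :: 'k kV)" for j
    using False by (simp add: gamma_word_length)
  ultimately show ?thesis by (simp only: sum.neutral_const)
qed

lemma tensor_map_gamma:
  "tensor_map gamma t (a, b) = lin_eval (\<lambda>(x, y). gamma_word x a * gamma_word y b) t"
  by (simp add: tensor_map_def lin_eval_def gamma_single ctensor_def split_def)


section \<open>Multiplicativity of gamma\<close>

text \<open>
  This is \<open>x\<^sup>N - y\<^sup>N = (x - y) \<Sum>\<^bsub>k<N\<^esub> x\<^sup>k y\<^sup>N\<^sup>-\<^sup>1\<^sup>-\<^sup>k\<close> with \<open>N = p - 1\<close> and \<open>k = n - 1\<close>; for \<open>p = 1\<close>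
  there are no splittings and both sides vanish.
\<close>

lemma sum_splittings_powers:
  fixes x y :: "'a::field"
  assumes "x \<noteq> y"
  shows "(\<Sum>(n, m) | n + m = p. x ^ (nat_of n - 1) * y ^ (nat_of m - 1))
       = (x ^ (nat_of p - 1) - y ^ (nat_of p - 1)) / (x - y)"
proof -
  let ?N = "nat_of p - 1"
  have pos: "nat_of n \<ge> 1" for n
    using nat_of_pos[of n] by simp
  have "(\<Sum>(n, m) | n + m = p. x ^ (nat_of n - 1) * y ^ (nat_of m - 1))
      = (\<Sum>k<?N. y ^ (?N - Suc k) * x ^ k)"
  proof (rule sum.reindex_bij_witness[where j = "\<lambda>(n, m). nat_of n - 1"
        and i = "\<lambda>k. (Abs_posnat (Suc k), Abs_posnat (?N - k))"])
    fix c
    assume "c \<in> {(n, m). n + m = p}"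
    then obtain n m where c: "c = (n, m)" and p: "nat_of p = nat_of n + nat_of m"
      by (auto simp: plus_posnat.rep_eq)
    have m: "?N - (nat_of n - 1) = nat_of m"
      using p pos[of n] by simp
    show "(\<lambda>k. (Abs_posnat (Suc k), Abs_posnat (?N - k))) (case c of (n, m) \<Rightarrow> nat_of n - 1) = c"
      by (simp only: c m prod.case Suc_diff_1 nat_of_pos nat_of_inverse)
    show "(case c of (n, m) \<Rightarrow> nat_of n - 1) \<in> {..<?N}"
      using p pos[of n] pos[of m] by (simp add: c)
    have "?N - Suc (nat_of n - 1) = nat_of m - 1"
      using m by simp
    then show "y ^ (?N - Suc (case c of (n, m) \<Rightarrow> nat_of n - 1)) *
        x ^ (case c of (n, m) \<Rightarrow> nat_of n - 1)
      = (case c of (n, m) \<Rightarrow> x ^ (nat_of n - 1) * y ^ (nat_of m - 1))"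
      by (simp add: c)
  next
    fix k
    assume k: "k \<in> {..<?N}"
    then show "(Abs_posnat (Suc k), Abs_posnat (?N - k)) \<in> {(n, m). n + m = p}"
      by (simp add: nat_of_inject[symmetric] plus_posnat.rep_eq Abs_posnat_inverse)
    show "(case (Abs_posnat (Suc k), Abs_posnat (?N - k)) of (n, m) \<Rightarrow> nat_of n - 1) = k"
      by (simp add: Abs_posnat_inverse)
  qed
  also have "\<dots> = (x ^ ?N - y ^ ?N) / (x - y)"
    using assms by (subst power_diff_sumr2) simp
  finally show ?thesis .
qed

lemma gamma_dqsh:
  assumes "set u \<inter> set v = {}"
  shows "gamma (dqsh u v) w = (cmult QSym_V (gamma_word u) (gamma_word v) w :: 'k::field kV)"
  using assms
proof (induction u v arbitrary: w rule: dqsh.induct)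
  case (1 v)
  have "(gamma_word [] :: _ \<Rightarrow> 'k kV) = (\<lambda>w. if w = [] then 1 else 0)"
    by (simp add: gamma_word_Nil fun_eq_iff)
  then show ?case
    by (simp add: cmult_unit_left gamma_single)
next
  case (2 i u)
  have "(gamma_word [] :: _ \<Rightarrow> 'k kV) = (\<lambda>w. if w = [] then 1 else 0)"
    by (simp add: gamma_word_Nil fun_eq_iff)
  then show ?case
    by (simp add: cmult_unit_right gamma_single)
next
  case (3 i u j v)
  let ?x = "scal_var i :: 'k kV" and ?y = "scal_var j :: 'k kV"
  have xy: "?x \<noteq> ?y"
    using "3.prems" by (auto simp: scal_var_eq_iff)
  show ?case
  proof (cases w)
    case Nil
    then show ?thesis
      by (simp add: cmult_Nil gamma_word_Cons_Nil gamma_eq_lin_eval lin_eval_add lin_eval_diff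
          lin_eval_smul lin_eval_prepend) (simp add: lin_eval_def)
  next
    case (Cons p w')
    let ?X = "?x ^ (nat_of p - 1)" and ?Y = "?y ^ (nat_of p - 1)"
    let ?c = "\<lambda>u v. cmult QSym_V (gamma_word u) (gamma_word v) w' :: 'k kV"
    have "gamma (dqsh (i # u) (j # v)) w
        = ?X * gamma (dqsh u (j # v)) w' + ?Y * gamma (dqsh (i # u) v) w'
          + (?X - ?Y) / (?x - ?y) * gamma (dqsh u v) w'"
      by (simp add: Cons gamma_eq_lin_eval lin_eval_add lin_eval_diff lin_eval_smul
          lin_eval_prepend gamma_word_Cons_Cons lin_eval_scale left_diff_distrib
          diff_divide_distrib)
    also have "\<dots> = ?X * ?c u (j # v) + ?Y * ?c (i # u) v + (?X - ?Y) / (?x - ?y) * ?c u v"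
      using "3.IH" "3.prems" by simp
    also have "(?X - ?Y) / (?x - ?y) * ?c u v
        = (\<Sum>(n, m) | n + m = p. ?x ^ (nat_of n - 1) * ?y ^ (nat_of m - 1) * ?c u v)"
      unfolding sum_splittings_powers[OF xy, symmetric] by (simp add: sum_distrib_right split_def)
    also have "?X * ?c u (j # v) + ?Y * ?c (i # u) v + \<dots>
        = cmult QSym_V (gamma_word (i # u)) (gamma_word (j # v)) w"
      by (simp add: Cons cmult_Cons gamma_word_Cons_Cons cmult_scale split_def)
         (simp add: mult_ac)
    finally show ?thesis .
  qed
qed

lemma gamma_gmult:
  fixes h h' :: "posnat list \<Rightarrow>\<^sub>0 'k::field kV"
  assumes "generic_position h h'"
  shows "gamma (bilin_ext dqsh h h') = cmult QSym_V (gamma h) (gamma h')"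
proof
  fix w
  have "gamma (bilin_ext dqsh h h') w
      = lin_eval (\<lambda>u. lin_eval (\<lambda>v. gamma (dqsh u v) w) h') h"
    by (simp add: gamma_eq_lin_eval bilin_ext_def lin_eval_lin_ext)
  also have "\<dots> = lin_eval (\<lambda>u. lin_eval
      (\<lambda>v. cmult QSym_V (gamma_word u) (gamma_word v) w) h') h"
    using assms unfolding generic_position_def generic_position_words_def
    by (intro lin_eval_cong gamma_dqsh) blast
  also have "\<dots> = cmult QSym_V (gamma h) (gamma h') w"
    by (simp add: gamma_eq_lin_eval[abs_def] cmult_lin_eval)
  finally show "gamma (bilin_ext dqsh h h') w = cmult QSym_V (gamma h) (gamma h') w" .
qed

theorem theorem21:
  shows "regularizing_bialgebra_map
           (QSh_gd :: (posnat, 'k::field_char_0 kV) generic_bialg) QSym_V gamma"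
proof -
  let ?H = "QSh_gd :: (posnat, 'k kV) generic_bialg"
  have len: "length w = r"
    if len_r: "\<forall>u\<in>keys h. length u = r" and nz: "gamma h w \<noteq> 0"
    for h :: "posnat list \<Rightarrow>\<^sub>0 'k kV" and w r
  proof -
    have "\<exists>u\<in>keys h. lookup h u * gamma_word u w \<noteq> 0"
      using nz unfolding gamma_def by (meson sum.neutral)
    then show ?thesis
      using len_r gamma_word_length by force
  qed
  have add: "gamma (h + h') = (\<lambda>w. gamma h w + gamma h' w)"
    for h h' :: "posnat list \<Rightarrow>\<^sub>0 'k kV"
    by (simp add: gamma_eq_lin_eval lin_eval_add fun_eq_iff)
  have smul: "gamma (smul c h) = (\<lambda>w. c * gamma h w)"
    for c and h :: "posnat list \<Rightarrow>\<^sub>0 'k kV"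
    by (simp add: gamma_eq_lin_eval lin_eval_smul fun_eq_iff)
  have unit: "gamma (gunit ?H) = cunit QSym_V"
    by (simp add: QSh_gd_def QSym_V_def gamma_single gamma_word_Nil fun_eq_iff)
  have mult: "gamma (gmult ?H h h') = cmult QSym_V (gamma h) (gamma h')"
    if "gpos ?H h h'" for h h'
    using that gamma_gmult by (simp add: QSh_gd_def)
  have comult: "tensor_map gamma (gcomult ?H h) = ccomult QSym_V (gamma h)" for h
  proof
    fix c :: "posnat list \<times> posnat list"
    obtain a b where c: "c = (a, b)" by (cases c)
    show "tensor_map gamma (gcomult ?H h) c = ccomult QSym_V (gamma h) c"
      by (simp add: c QSh_gd_def tensor_map_gamma lin_eval_lin_ext lin_eval_deconc
          gamma_word_deconc ccomult_QSym_V gamma_eq_lin_eval)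
  qed
  show ?thesis
    unfolding regularizing_bialgebra_map_def
    using add smul len unit mult comult by blast
qed

end
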